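(* Let $\mathfrak{A}$ be a non-empty index set, let $\mathfrak{B}$ be an index set, and let $(\mathcal{X}_{\alpha\beta})_{(\alpha,\beta)\in\mathfrak{A}\times\mathfrak{B}}$ be a family in $\Lambda$ such that the $\sigma$-fields $\mathcal{Z}_\beta:=\lor_{\alpha\in\mathfrak{A}}\mathcal{X}_{\alpha\beta}$, $\beta\in\mathfrak{B}$, are independent. Then $$\land_{\alpha\in\mathfrak{A}}\lor_{\beta\in\mathfrak{B}}\mathcal{X}_{\alpha\beta}=\lor_{\beta\in\mathfrak{B}}\land_{\alpha\in\mathfrak{A}}\mathcal{X}_{\alpha\beta}.$$
   Context: $(\Omega,\mathcal{M},\mathbb{P})$ is a probability space ($\mathbb{P}$ itself need not be complete). $0_\Lambda:=\mathbb{P}^{-1}(\{0,1\})$ is the collection of all events of $\mathcal{M}$ having probability $0$ or $1$. A sub-$\sigma$-field of $\mathcal{M}$ is called complete if it contains $0_\Lambda$, and $\Lambda$ denotes the collection of all complete sub-$\sigma$-fields of $\mathcal{M}$. For a family $(\mathcal{X}_t)_{t\in T}$ in $\Lambda$: $\lor_{t\in T}\mathcal{X}_t$ is the smallest complete sub-$\sigma$-field of $\mathcal{M}$ containing $\cup_{t\in T}\mathcal{X}_t$ (equal to $0_\Lambda$ when $T=\emptyset$); if $T\neq\emptyset$, $\land_{t\in T}\mathcal{X}_t:=\cap_{t\in T}\mathcal{X}_t$. Index sets are arbitrary (not necessarily countable). Independence is with respect to $\mathbb{P}$; a family of $\sigma$-fields is independent if every finite subfamily is (mutually) independent. *)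

theory Defs
  imports "HOL-Probability.Probability"
begin

definition trivial_events :: "'a measure \<Rightarrow> 'a set set" where
  "trivial_events M = {E \<in> sets M. measure M E \<in> {0, 1}}"

text \<open>Sub-sigma-fields are represented as sets of events rather than as values of type
  \<^typ>\<open>'a measure\<close>, so that equality of sigma-fields is equality of sets. Completeness is
  relative to the events of \<^term>\<open>M\<close>; the measure \<^term>\<open>M\<close> itself need not be complete.\<close>

definition complete_subfields :: "'a measure \<Rightarrow> 'a set set set" where
  "complete_subfields M =
     {F. sigma_algebra (space M) F \<and> F \<subseteq> sets M \<and> trivial_events M \<subseteq> F}"

definition join_fields :: "'a measure \<Rightarrow> 't set \<Rightarrow> ('t \<Rightarrow> 'a set set) \<Rightarrow> 'a set set" where
  "join_fields M T X = \<Inter>{F \<in> complete_subfields M. (\<Union>t\<in>T. X t) \<subseteq> F}"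

text \<open>This is only meaningful for a non-empty index set.\<close>

definition meet_fields :: "'t set \<Rightarrow> ('t \<Rightarrow> 'a set set) \<Rightarrow> 'a set set" where
  "meet_fields T X = (\<Inter>t\<in>T. X t)"

lemma sets_in_complete_subfields: "sets M \<in> complete_subfields M"
  by (auto simp: complete_subfields_def trivial_events_def sets.sigma_algebra_axioms)

lemma Inter_in_complete_subfields:
  assumes "S \<noteq> {}" "S \<subseteq> complete_subfields M"
  shows "\<Inter>S \<in> complete_subfields M"
proof -
  have S: "\<And>F. F \<in> S \<Longrightarrow> sigma_algebra (space M) F \<and> F \<subseteq> sets M \<and> trivial_events M \<subseteq> F"
    using assms(2) by (auto simp: complete_subfields_def)
  have "sigma_algebra (space M) (\<Inter>S)"
    unfolding sigma_algebra_iff2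
  proof (intro conjI ballI allI impI)
    show "\<Inter>S \<subseteq> Pow (space M)"
      using assms(1) S sets.space_closed by blast
    show "{} \<in> \<Inter>S"
      using S by (auto simp: sigma_algebra_iff2)
  next
    fix s assume "s \<in> \<Inter>S"
    then show "space M - s \<in> \<Inter>S"
      using S by (auto simp: sigma_algebra_iff2)
  next
    fix A :: "nat \<Rightarrow> 'a set" assume A: "range A \<subseteq> \<Inter>S"
    show "(\<Union>i. A i) \<in> \<Inter>S"
    proof
      fix F assume F: "F \<in> S"
      then have "range A \<subseteq> F" using A by blast
      then show "(\<Union>i. A i) \<in> F"
        using S[OF F] unfolding sigma_algebra_iff2 by blast
    qed
  qed
  then show ?thesis
    using assms(1) S unfolding complete_subfields_def by blast
qed

lemma meet_fields_in_complete_subfields: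
  assumes "T \<noteq> {}" "\<And>t. t \<in> T \<Longrightarrow> X t \<in> complete_subfields M"
  shows "meet_fields T X \<in> complete_subfields M"
  using Inter_in_complete_subfields[of "X ` T" M] assms by (auto simp: meet_fields_def)

lemma join_fields_upper: "t \<in> T \<Longrightarrow> X t \<subseteq> join_fields M T X"
  by (auto simp: join_fields_def)

lemma join_fields_least:
  "F \<in> complete_subfields M \<Longrightarrow> (\<And>t. t \<in> T \<Longrightarrow> X t \<subseteq> F) \<Longrightarrow> join_fields M T X \<subseteq> F"
  unfolding join_fields_def by blast

lemma join_fields_in_complete_subfields:
  assumes "\<And>t. t \<in> T \<Longrightarrow> X t \<in> complete_subfields M"
  shows "join_fields M T X \<in> complete_subfields M"
  unfolding join_fields_def
proof (rule Inter_in_complete_subfields)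
  have "\<And>t. t \<in> T \<Longrightarrow> X t \<subseteq> sets M"
    using assms by (auto simp: complete_subfields_def)
  then have "sets M \<in> {F \<in> complete_subfields M. (\<Union>t\<in>T. X t) \<subseteq> F}"
    using sets_in_complete_subfields by blast
  then show "{F \<in> complete_subfields M. (\<Union>t\<in>T. X t) \<subseteq> F} \<noteq> {}"
    by blast
qed blast

lemma join_fields_empty:
  assumes "prob_space M"
  shows "join_fields M {} X = trivial_events M"
proof -
  interpret prob_space M by fact
  have "sigma_algebra (space M) (trivial_events M)"
    unfolding sigma_algebra_iff2
  proof (intro conjI ballI allI impI)
    show "trivial_events M \<subseteq> Pow (space M)"
      using sets.space_closed by (auto simp: trivial_events_def)
    show "{} \<in> trivial_events M"
      by (simp add: trivial_events_def)
  next
    fix s assume "s \<in> trivial_events M"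
    then show "space M - s \<in> trivial_events M"
      by (auto simp: trivial_events_def prob_compl)
  next
    fix E :: "nat \<Rightarrow> 'a set" assume E: "range E \<subseteq> trivial_events M"
    then have ev: "\<And>i. E i \<in> events" and p: "\<And>i. prob (E i) = 0 \<or> prob (E i) = 1"
      by (auto simp: trivial_events_def)
    show "(\<Union>i. E i) \<in> trivial_events M"
    proof (cases "\<exists>i. prob (E i) = 1")
      case True
      then obtain i where "prob (E i) = 1" by blast
      moreover have "prob (E i) \<le> prob (\<Union>i. E i)"
        using ev by (intro finite_measure_mono) auto
      ultimately have "prob (\<Union>i. E i) = 1"
        using prob_le_1[of "\<Union>i. E i"] by linarith
      then show ?thesis using ev by (auto simp: trivial_events_def)
    next
      case False
      then have "\<And>i. prob (E i) = 0" using p by blast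
      then have "\<And>i. E i \<in> null_sets M"
        using ev by (intro null_setsI) (simp_all add: emeasure_eq_measure)
      then have "(\<Union>i. E i) \<in> null_sets M"
        by (rule null_sets_UN)
      then have "prob (\<Union>i. E i) = 0"
        by (simp add: measure_def null_setsD1)
      then show ?thesis using ev by (auto simp: trivial_events_def)
    qed
  qed
  then have "trivial_events M \<in> complete_subfields M"
    unfolding complete_subfields_def trivial_events_def by blast
  then show ?thesis
    unfolding join_fields_def complete_subfields_def by blast
qed

end

(* Let Y_b be the meet over a of X_ab. The Hilbert space picture is that L2 of a join of independent
   fields is a tensor product, and that tensor products commute with intersections of subspaces.
   Concretely: if f lies in the join of P and X_a for every a, where P is independent of a field Z
   containing all X_a, then E[f | Z] = E[f | X_a] for every a, so E[f | Z] is measurable with respect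
   to the meet Y of the X_a (completeness absorbs the null sets). Hence in E[f g h], with g in P and
   h in Z, the factor h may be replaced by E[h | Y].

   For f the indicator of an event in the meet of the joins, and f' = E[f | join of the Y_b], applying
   this to one index b at a time gives E[f prod h_b] = E[f prod E[h_b | Y_b]] for every finite product
   with h_b in Z_b, and likewise for f'. The right-hand sides for f and f' agree, so f = f' almost
   surely because the finite products determine functions on the join of the Z_b. *)

theory Submission
  imports Defs
begin

section \<open>Integrals over generated sigma-fields\<close>

text \<open>Dynkin's pi-lambda argument: the sets on which the two integrals agree are closed under
  countable disjoint unions by countable additivity. Closure under complements also uses
  \<open>space M \<in> G\<close>, which makes the total integrals agree.\<close>

lemma set_integral_eq_on_sigma_sets:
  fixes u v :: "'a \<Rightarrow> real"
  assumes u: "integrable M u" and v: "integrable M v"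
    and G: "Int_stable G" "G \<subseteq> sets M" "space M \<in> G"
    and eq: "\<And>C. C \<in> G \<Longrightarrow> (LINT x:C|M. u x) = (LINT x:C|M. v x)"
    and C: "C \<in> sigma_sets (space M) G"
  shows "(LINT x:C|M. u x) = (LINT x:C|M. v x)"
proof -
  have closed: "G \<subseteq> Pow (space M)"
    using G(2) sets.space_closed by blast
  have sub: "sigma_sets (space M) G \<subseteq> sets M"
    using G(2) by (rule sets.sigma_sets_subset)
  have int: "set_integrable M D w" if "D \<in> sets M" "integrable M w" for D and w :: "'a \<Rightarrow> real"
    unfolding set_integrable_def by (rule integrable_mult_indicator[OF that])
  show ?thesis
    using G(1) closed C
  proof (induction rule: sigma_sets_induct_disjoint)
    case (basic D)
    then show ?case by (rule eq)
  next
    case empty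
    show ?case by (simp add: set_lebesgue_integral_def)
  next
    case (compl D)
    have D: "D \<in> sets M" using compl(1) sub by blast
    have "(LINT x:space M - D|M. w x) = (LINT x:space M|M. w x) - (LINT x:D|M. w x)"
      if "integrable M w" for w :: "'a \<Rightarrow> real"
    proof -
      have "(LINT x:(space M - D) \<union> D|M. w x) = (LINT x:space M - D|M. w x) + (LINT x:D|M. w x)"
        using D that by (intro set_integral_Un int) auto
      moreover have "(space M - D) \<union> D = space M"
        using sets.sets_into_space[OF D] by blast
      ultimately show ?thesis by simp
    qed
    then show ?case using compl(2) eq[OF G(3)] u v by simp
  next
    case (union D)
    have D: "\<And>i. D i \<in> sets M" using union(2) sub by blast
    have "(LINT x:(\<Union>i. D i)|M. w x) = (\<Sum>i. LINT x:D i|M. w x)"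
      if "integrable M w" for w :: "'a \<Rightarrow> real"
      using D union(1) that
      by (intro lebesgue_integral_countable_add int) (auto simp: disjoint_family_on_def)
    then show ?case using union(3) u v by simp
  qed
qed

lemma subalgebra_sigma:
  assumes "G \<subseteq> sets M"
  shows "subalgebra M (sigma (space M) G)"
  using assms sets.sigma_sets_subset[OF assms] sets.space_closed[of M]
  by (auto simp: subalgebra_def sets_measure_of[OF order_trans])

lemma subalgebra_trans: "subalgebra M F \<Longrightarrow> subalgebra F G \<Longrightarrow> subalgebra M G"
  by (auto simp: subalgebra_def)

section \<open>Conditional expectation and independence\<close>

context prob_space
begin

lemma finite_measure_subalgebraI: "subalgebra M F \<Longrightarrow> finite_measure_subalgebra M F"
  by (simp add: finite_measure_axioms finite_measure_subalgebra.intro finite_measure_subalgebra_axioms.intro)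

text \<open>The sigma-fields generated by \<open>f\<close> and \<open>g\<close> lie in
  \<open>sets P\<close> and \<open>sets Z\<close>, so the two functions are independent random
  variables and the product rule for expectations applies.\<close>

lemma indep_set_integral_mult:
  fixes f g :: "'a \<Rightarrow> real"
  assumes ind: "indep_set (sets P) (sets Z)"
    and P: "subalgebra M P" and Z: "subalgebra M Z"
    and f: "f \<in> borel_measurable P" "integrable M f"
    and g: "g \<in> borel_measurable Z" "integrable M g"
  shows "(LINT x|M. f x * g x) = (LINT x|M. f x) * (LINT x|M. g x)"
proof (rule indep_var_lebesgue_integral)
  have sub: "sigma_sets (space M) {h -` A \<inter> space M |A. A \<in> sets borel} \<subseteq> sets F"
    if F: "subalgebra M F" and h: "h \<in> borel_measurable F" for F and h :: "'a \<Rightarrow> real"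
  proof -
    have sp: "space F = space M" using F by (simp add: subalgebra_def)
    have "{h -` A \<inter> space F |A. A \<in> sets borel} \<subseteq> sets F"
      using measurable_sets[OF h] by auto
    from sets.sigma_sets_subset[OF this] show ?thesis by (simp only: sp)
  qed
  show "indep_var borel f borel g"
    unfolding indep_var_eq indep_set_def
  proof (intro conjI)
    show "indep_sets (case_bool (sigma_sets (space M) {f -` A \<inter> space M |A. A \<in> sets borel})
      (sigma_sets (space M) {g -` A \<inter> space M |A. A \<in> sets borel})) UNIV"
      using ind unfolding indep_set_def
      by (rule indep_sets_mono_sets) (use sub[OF P f(1)] sub[OF Z g(1)] in \<open>auto split: bool.split\<close>)
  qed (use f g in auto)
qed fact+

text \<open>Information independent of \<open>Z\<close> does not improve the prediction of a
  \<open>Z\<close>-measurable function from \<open>X\<close>. It suffices to compare integrals over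
  rectangles \<open>p \<inter> q\<close> with \<open>p\<close> in \<open>P\<close> and
  \<open>q\<close> in \<open>X\<close>: independence splits off the probability of \<open>p\<close>,
  and over \<open>q\<close> the defining property of conditional expectation remains.\<close>

lemma cond_exp_join_indep:
  fixes h :: "'a \<Rightarrow> real"
  assumes ind: "indep_set (sets P) (sets Z)"
    and P: "subalgebra M P" and Z: "subalgebra M Z" and X: "subalgebra Z X"
    and h: "h \<in> borel_measurable Z" "integrable M h"
  shows "AE x in M. real_cond_exp M (sigma (space M) (sets P \<union> sets X)) h x = real_cond_exp M X h x"
proof -
  define V where "V = sigma (space M) (sets P \<union> sets X)"
  have MX: "subalgebra M X" using Z X by (rule subalgebra_trans)
  have PX: "sets P \<union> sets X \<subseteq> sets M" using P MX by (auto simp: subalgebra_def)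
  have V: "subalgebra M V" unfolding V_def using PX by (rule subalgebra_sigma)
  interpret V: finite_measure_subalgebra M V using V by (rule finite_measure_subalgebraI)
  interpret X: finite_measure_subalgebra M X using MX by (rule finite_measure_subalgebraI)
  have spP: "space P = space M" and spX: "space X = space M"
    using P MX by (auto simp: subalgebra_def)
  have [measurable]: "h \<in> borel_measurable M" using h by auto
  define k where "k = real_cond_exp M X h"
  have k: "integrable M k" "k \<in> borel_measurable X" "k \<in> borel_measurable Z"
    unfolding k_def using h X.real_cond_exp_int(1) measurable_from_subalg[OF X borel_measurable_cond_exp] by auto
  define G where "G = {p \<inter> q |p q. p \<in> sets P \<and> q \<in> sets X}"
  have GP: "sets P \<union> sets X \<subseteq> G"
  proof
    fix c assume "c \<in> sets P \<union> sets X"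
    then have "c = c \<inter> space M \<and> c \<in> sets P \<or> c = space M \<inter> c \<and> c \<in> sets X"
      using PX sets.sets_into_space[of c M] by blast
    moreover have "space M \<in> sets P" "space M \<in> sets X"
      using sets.top[of P] sets.top[of X] by (simp_all add: spP spX)
    ultimately show "c \<in> G" unfolding G_def by blast
  qed
  have GM: "G \<subseteq> sets M" using PX by (auto simp: G_def)
  have "Int_stable G"
  proof (rule Int_stableI)
    fix a b assume "a \<in> G" "b \<in> G"
    then obtain p q p' q' where pq: "p \<in> sets P" "q \<in> sets X" "p' \<in> sets P" "q' \<in> sets X"
      and ab: "a = p \<inter> q" "b = p' \<inter> q'" unfolding G_def by blast
    have "a \<inter> b = (p \<inter> p') \<inter> (q \<inter> q')" using ab by blast
    then show "a \<inter> b \<in> G" unfolding G_def using pq by blast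
  qed
  have on_G: "(LINT x:C|M. h x) = (LINT x:C|M. k x)" if "C \<in> G" for C
  proof -
    obtain p q where p: "p \<in> sets P" and q: "q \<in> sets X" and C: "C = p \<inter> q"
      using \<open>C \<in> G\<close> unfolding G_def by blast
    have pM: "p \<in> sets M" and qM: "q \<in> sets M" and qZ: "q \<in> sets Z"
      using PX p q X by (auto simp: subalgebra_def)
    \<comment> \<open>Stated for a general \<open>w\<close>, because it serves both \<open>h\<close>
      and \<open>k\<close>: each is \<open>Z\<close>-measurable, \<open>k\<close> because
      \<open>X\<close> is a subfield of \<open>Z\<close>.\<close>
    have "(LINT x:C|M. w x) = (LINT x|M. indicator p x) * (LINT x:q|M. w x)"
      if w: "w \<in> borel_measurable Z" "integrable M w" for w :: "'a \<Rightarrow> real"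
    proof -
      have "(LINT x:C|M. w x) = (LINT x|M. indicator p x * (indicator q x * w x))"
        by (simp add: C set_lebesgue_integral_def indicator_inter_arith mult.assoc)
      moreover have "integrable M (indicator p :: 'a \<Rightarrow> real)"
        using pM by (intro integrable_real_indicator) (auto simp: less_top[symmetric])
      then have "(LINT x|M. indicator p x * (indicator q x * w x)) =
          (LINT x|M. indicator p x) * (LINT x|M. indicator q x * w x)"
        using integrable_mult_indicator[OF qM w(2)] w p pM qZ
        by (intro indep_set_integral_mult[OF ind P Z]) auto
      ultimately show ?thesis by (simp add: set_lebesgue_integral_def)
    qed
    then show ?thesis
      using h k X.real_cond_exp_intA[OF h(2) q] by (simp add: k_def)
  qed
  have V_eq: "sets V = sigma_sets (space M) (sets P \<union> sets X)"
    unfolding V_def by (rule sets_measure_of) (use PX sets.space_closed in blast)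
  then have VG: "sets V \<subseteq> sigma_sets (space M) G"
    using sigma_sets_mono'[OF GP] by simp
  have "sets X \<subseteq> sets V"
    unfolding V_eq by auto
  then have XV: "subalgebra V X"
    by (simp add: subalgebra_def V_def spX space_measure_of_conv)
  have "AE x in M. real_cond_exp M V h x = k x"
  proof (rule V.real_cond_exp_charact)
    fix C assume "C \<in> sets V"
    then show "(LINT x:C|M. h x) = (LINT x:C|M. k x)"
      using VG GP sets.top[of P]
      by (intro set_integral_eq_on_sigma_sets[OF h(2) k(1) \<open>Int_stable G\<close> GM _ on_G]) (auto simp: spP)
  qed (use h k measurable_from_subalg[OF XV] in auto)
  then show ?thesis by (simp add: V_def k_def)
qed

end

text \<open>Preimages under \<open>k\<close> and \<open>k'\<close> differ only inside the
  exceptional null set, and \<open>F\<close> contains every null event. This is how completeness of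
  the subfields enters.\<close>

lemma borel_measurable_AE_eq_null_sets:
  fixes k k' :: "'a \<Rightarrow> real"
  assumes F: "subalgebra M F" "null_sets M \<subseteq> sets F"
    and k': "k' \<in> borel_measurable F" and k: "k \<in> borel_measurable M"
    and eq: "AE x in M. k x = k' x"
  shows "k \<in> borel_measurable F"
proof (rule measurableI)
  have sp: "space F = space M" using F by (simp add: subalgebra_def)
  have k'M [measurable]: "k' \<in> borel_measurable M" using measurable_from_subalg[OF F(1) k'] .
  note k[measurable]
  define N where "N = {x \<in> space M. k x \<noteq> k' x}"
  have N: "N \<in> null_sets M"
    using eq unfolding N_def by (subst (asm) AE_iff_null) auto
  fix S :: "real set" assume S [measurable]: "S \<in> sets borel"
  \<comment> \<open>Measurability of \<open>k\<close> with respect to \<open>M\<close> makes this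
    subset of \<open>N\<close> an event, so it is a null set even if \<open>M\<close> is
    incomplete.\<close>
  have "k -` S \<inter> space M \<inter> N \<in> null_sets M"
    using N by (intro null_set_Int1) auto
  moreover have "k' -` S \<inter> space M \<in> sets F"
    using measurable_sets[OF k' S] by (simp add: sp)
  moreover have "k -` S \<inter> space M = (k' -` S \<inter> space M - N) \<union> (k -` S \<inter> space M \<inter> N)"
    by (auto simp: N_def)
  moreover have "N \<in> sets F" using F(2) N by blast
  ultimately show "k -` S \<inter> space F \<in> sets F"
    using F(2) by (metis sets.Diff sets.Un sp subsetD)
qed simp

section \<open>Bounded functions and the replacement of one factor\<close>

context prob_space
begin

text \<open>The unit ball of L-infinity over \<open>F\<close>. The bound is only almost sure, so
  that the class is stable under conditional expectation; being stable under products as well, it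
  settles all integrability questions below.\<close>

definition contractions :: "'a measure \<Rightarrow> ('a \<Rightarrow> real) set" where
  "contractions F = {f \<in> borel_measurable F. AE x in M. \<bar>f x\<bar> \<le> 1}"

lemma contractions_measurable: "f \<in> contractions F \<Longrightarrow> f \<in> borel_measurable F"
  by (simp add: contractions_def)

lemma contractions_mono: "subalgebra G F \<Longrightarrow> f \<in> contractions F \<Longrightarrow> f \<in> contractions G"
  by (auto simp: contractions_def intro: measurable_from_subalg)

lemma contractions_integrable: "f \<in> contractions M \<Longrightarrow> integrable M f"
  by (auto simp: contractions_def intro: integrable_const_bound[where B = 1])

lemma contractions_mult:
  assumes "f \<in> contractions F" "g \<in> contractions F"
  shows "(\<lambda>x. f x * g x) \<in> contractions F"
proof -
  have "AE x in M. \<bar>f x\<bar> \<le> 1" "AE x in M. \<bar>g x\<bar> \<le> 1"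
    using assms by (auto simp: contractions_def)
  then have "AE x in M. \<bar>f x * g x\<bar> \<le> 1"
    by eventually_elim (auto simp: abs_mult intro: mult_le_one)
  then show ?thesis using assms by (auto simp: contractions_def)
qed

lemma contractions_prod:
  "(\<And>i. i \<in> I \<Longrightarrow> f i \<in> contractions F) \<Longrightarrow> (\<lambda>x. \<Prod>i\<in>I. f i x) \<in> contractions F"
proof (induction I rule: infinite_finite_induct)
  case (insert i I)
  then show ?case using contractions_mult[of "f i"] by simp
qed (simp_all add: contractions_def)

lemma contractions_indicator: "D \<in> sets F \<Longrightarrow> indicator D \<in> contractions F"
  by (auto simp: contractions_def indicator_def)

lemma contractions_cond_exp:
  assumes "subalgebra M F" "f \<in> contractions M"
  shows "real_cond_exp M F f \<in> contractions F"
proof -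
  interpret F: finite_measure_subalgebra M F using assms(1) by (rule finite_measure_subalgebraI)
  have f: "integrable M f" using assms(2) by (rule contractions_integrable)
  have "AE x in M. \<bar>f x\<bar> \<le> 1" using assms(2) by (simp add: contractions_def)
  then have "AE x in M. f x \<ge> -1" "AE x in M. f x \<le> 1" by (auto elim: eventually_mono)
  then have "AE x in M. real_cond_exp M F f x \<ge> -1" "AE x in M. real_cond_exp M F f x \<le> 1"
    using F.real_cond_exp_ge_c[OF f] F.real_cond_exp_le_c[OF f] by auto
  then have "AE x in M. \<bar>real_cond_exp M F f x\<bar> \<le> 1"
    by eventually_elim auto
  then show ?thesis by (simp add: contractions_def)
qed

text \<open>Conditional expectation as an orthogonal projection: testing against an
  \<open>F\<close>-measurable function does not see the difference between \<open>g\<close> and its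
  projection. Two applications give self-adjointness.\<close>

lemma integral_mult_cond_exp:
  assumes F: "subalgebra M F" and f: "f \<in> contractions F" and g: "g \<in> contractions M"
  shows "(LINT x|M. f x * real_cond_exp M F g x) = (LINT x|M. f x * g x)"
proof -
  interpret F: finite_measure_subalgebra M F using F by (rule finite_measure_subalgebraI)
  show ?thesis
    using f g contractions_mono[OF F f]
    by (intro F.real_cond_exp_intg contractions_integrable contractions_mult contractions_measurable)
qed

text \<open>The replacement rule for one factor. The projection \<open>k\<close> of \<open>W\<close>
  to \<open>Z\<close> agrees almost surely with the projection to each \<open>X \<alpha>\<close>,
  hence is measurable for their intersection \<open>Y\<close>.\<close>

lemma integral_mult_cond_exp_Inter:
  assumes ind: "indep_set (sets P) (sets Z)"
    and P: "subalgebra M P" and Z: "subalgebra M Z"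
    and A: "A \<noteq> {}" and X: "\<And>\<alpha>. \<alpha> \<in> A \<Longrightarrow> subalgebra Z (X \<alpha>)"
    and null: "\<And>\<alpha>. \<alpha> \<in> A \<Longrightarrow> null_sets M \<subseteq> sets (X \<alpha>)"
    and Y: "subalgebra M Y" "sets Y = (\<Inter>\<alpha>\<in>A. sets (X \<alpha>))"
    and W: "\<And>\<alpha>. \<alpha> \<in> A \<Longrightarrow> W \<in> contractions (sigma (space M) (sets P \<union> sets (X \<alpha>)))"
    and h: "h \<in> contractions Z"
  shows "(LINT x|M. W x * h x) = (LINT x|M. W x * real_cond_exp M Y h x)"
proof -
  interpret Z: finite_measure_subalgebra M Z using Z by (rule finite_measure_subalgebraI)
  have MX: "subalgebra M (X \<alpha>)" if "\<alpha> \<in> A" for \<alpha>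
    using Z X[OF that] by (rule subalgebra_trans)
  have V: "subalgebra M (sigma (space M) (sets P \<union> sets (X \<alpha>)))" if "\<alpha> \<in> A" for \<alpha>
    using P MX[OF that] by (intro subalgebra_sigma) (auto simp: subalgebra_def)
  have WM: "W \<in> contractions M"
    using A W V contractions_mono by blast
  define k where "k = real_cond_exp M Z W"
  have kZ: "k \<in> contractions Z" and kM: "k \<in> contractions M"
    unfolding k_def using Z WM contractions_mono contractions_cond_exp by blast+
  have "k \<in> borel_measurable (X \<alpha>)" if \<alpha>: "\<alpha> \<in> A" for \<alpha>
  proof (rule borel_measurable_AE_eq_null_sets[OF MX[OF \<alpha>] null[OF \<alpha>]])
    let ?X = "X \<alpha>" and ?V = "sigma (space M) (sets P \<union> sets (X \<alpha>))"
    note ce = contractions_cond_exp[OF MX[OF \<alpha>]]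
    show "AE x in M. k x = real_cond_exp M ?X W x"
      unfolding k_def
    proof (rule Z.real_cond_exp_charact)
      fix D assume "D \<in> sets Z"
      then have D: "indicator D \<in> contractions Z" by (rule contractions_indicator)
      have DM: "indicator D \<in> contractions M" using contractions_mono[OF Z D] .
      have eq: "AE x in M. real_cond_exp M ?V (indicator D) x = real_cond_exp M ?X (indicator D) x"
        by (rule cond_exp_join_indep[OF ind P Z X[OF \<alpha>] contractions_measurable[OF D] contractions_integrable[OF DM]])
      \<comment> \<open>Since \<open>W\<close> is \<open>?V\<close>-measurable, the indicator may be
        projected to \<open>?V\<close>; by independence this is its projection to \<open>?X\<close>,
        and self-adjointness then moves the projection over to \<open>W\<close>.\<close>
      have "(LINT x|M. W x * indicator D x) = (LINT x|M. W x * real_cond_exp M ?V (indicator D) x)"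
        by (rule integral_mult_cond_exp[OF V[OF \<alpha>] W[OF \<alpha>] DM, symmetric])
      also have "\<dots> = (LINT x|M. W x * real_cond_exp M ?X (indicator D) x)"
        using eq contractions_measurable[OF WM] by (intro integral_cong_AE) auto
      also have "\<dots> = (LINT x|M. real_cond_exp M ?X (indicator D) x * real_cond_exp M ?X W x)"
        using integral_mult_cond_exp[OF MX[OF \<alpha>] ce[OF DM] WM] by (simp add: mult.commute)
      also have "\<dots> = (LINT x|M. real_cond_exp M ?X W x * indicator D x)"
        using integral_mult_cond_exp[OF MX[OF \<alpha>] ce[OF WM] DM] by (simp add: mult.commute)
      finally show "(LINT x:D|M. W x) = (LINT x:D|M. real_cond_exp M ?X W x)"
        by (simp add: set_lebesgue_integral_def mult.commute)
    next
      show "real_cond_exp M ?X W \<in> borel_measurable Z"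
        by (rule measurable_from_subalg[OF X[OF \<alpha>] borel_measurable_cond_exp])
    qed (use WM ce[OF WM] contractions_mono[OF MX[OF \<alpha>]] contractions_integrable in auto)
  qed (use contractions_measurable[OF kM] in auto)
  \<comment> \<open>One fixed version \<open>k\<close> is measurable for every
    \<open>X \<alpha>\<close>, so its preimages lie in the intersection even when \<open>A\<close>
    is uncountable.\<close>
  then have "k \<in> borel_measurable Y"
    using A X MX Y by (auto simp: measurable_def subalgebra_def)
  then have kY: "k \<in> contractions Y" using kZ by (simp add: contractions_def)
  have ZY: "subalgebra Z Y"
    using A X Y Z by (fastforce simp: subalgebra_def)
  have hM: "h \<in> contractions M" using contractions_mono[OF Z h] .
  have hY: "real_cond_exp M Y h \<in> contractions Z"
    using contractions_mono[OF ZY contractions_cond_exp[OF Y(1) hM]] .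
  \<comment> \<open>Pass from \<open>W\<close> to \<open>k\<close>, project \<open>h\<close> to
    \<open>Y\<close> against the \<open>Y\<close>-measurable \<open>k\<close>, and return from
    \<open>k\<close> to \<open>W\<close>; the return is allowed because the projected
    \<open>h\<close> is still \<open>Z\<close>-measurable.\<close>
  have "(LINT x|M. h x * W x) = (LINT x|M. h x * k x)"
    unfolding k_def by (rule integral_mult_cond_exp[OF Z h WM, symmetric])
  also have "\<dots> = (LINT x|M. real_cond_exp M Y h x * k x)"
    using integral_mult_cond_exp[OF Y(1) kY hM] by (simp add: mult.commute)
  also have "\<dots> = (LINT x|M. real_cond_exp M Y h x * W x)"
    unfolding k_def by (rule integral_mult_cond_exp[OF Z hY WM])
  finally show ?thesis by (simp add: mult.commute)
qed

end

section \<open>Complete subfields as generated sigma-fields and subalgebras\<close>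

text \<open>For nonempty \<open>T\<close> some \<open>X t\<close> already contains the trivial
  events, so the generated sigma-field is complete without adjoining them. For empty
  \<open>T\<close> the right side could be too small.\<close>

lemma join_fields_eq_sigma_sets:
  assumes "T \<noteq> {}" and X: "\<And>t. t \<in> T \<Longrightarrow> X t \<in> complete_subfields M"
  shows "join_fields M T X = sigma_sets (space M) (\<Union>t\<in>T. X t)"
proof
  have sub: "(\<Union>t\<in>T. X t) \<subseteq> sets M"
    using X by (auto simp: complete_subfields_def)
  then have "(\<Union>t\<in>T. X t) \<subseteq> Pow (space M)"
    using sets.space_closed by blast
  moreover have "trivial_events M \<subseteq> sigma_sets (space M) (\<Union>t\<in>T. X t)"
    using assms by (fastforce simp: complete_subfields_def)
  ultimately have "sigma_sets (space M) (\<Union>t\<in>T. X t) \<in> complete_subfields M"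
    using sets.sigma_sets_subset[OF sub]
    by (simp add: complete_subfields_def sigma_algebra_sigma_sets)
  then show "join_fields M T X \<subseteq> sigma_sets (space M) (\<Union>t\<in>T. X t)"
    by (rule join_fields_least) auto
  have "sigma_algebra (space M) (join_fields M T X)"
    using join_fields_in_complete_subfields[of T X M] X by (simp add: complete_subfields_def)
  then show "sigma_sets (space M) (\<Union>t\<in>T. X t) \<subseteq> join_fields M T X"
    using join_fields_upper[of _ T X M] by (intro sigma_algebra.sigma_sets_subset) blast+
qed

text \<open>Bridge between fields as sets of events and the measure-typed fields expected by
  \<open>subalgebra\<close> and \<open>real_cond_exp\<close>, where only the space and the sets of
  \<open>sigma (space M) F\<close> matter.\<close>

lemma sets_sigma_complete_subfield:
  "F \<in> complete_subfields M \<Longrightarrow> sets (sigma (space M) F) = F"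
  by (simp add: complete_subfields_def sigma_algebra.sets_measure_of_eq)

lemma subalgebra_complete_subfields:
  assumes "F \<in> complete_subfields M" "G \<in> complete_subfields M" "G \<subseteq> F"
  shows "subalgebra (sigma (space M) F) (sigma (space M) G)"
  using assms by (simp add: subalgebra_def sets_sigma_complete_subfield space_measure_of_conv)

lemma subalgebra_complete_subfield:
  "F \<in> complete_subfields M \<Longrightarrow> subalgebra M (sigma (space M) F)"
  by (intro subalgebra_sigma) (simp add: complete_subfields_def)

lemma null_sets_complete_subfield:
  "F \<in> complete_subfields M \<Longrightarrow> null_sets M \<subseteq> sets (sigma (space M) F)"
  by (auto simp: sets_sigma_complete_subfield complete_subfields_def trivial_events_def measure_def null_sets_def)

section \<open>Grouping independent fields, and finite cylinders\<close>

context prob_space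
begin

text \<open>Independence survives grouping along the partition of \<open>B\<close> into
  \<open>B - {\<beta>}\<close> and \<open>{\<beta>}\<close>; the field generated by the second block
  is then shrunk to \<open>Z \<beta>\<close>.\<close>

lemma indep_set_rest:
  assumes "indep_sets Z B" "\<beta> \<in> B" "\<And>\<beta>. \<beta> \<in> B \<Longrightarrow> Int_stable (Z \<beta>)"
  shows "indep_set (sigma_sets (space M) (\<Union>\<gamma>\<in>B - {\<beta>}. Z \<gamma>)) (Z \<beta>)"
proof -
  let ?I = "\<lambda>j. if j then B - {\<beta>} else {\<beta>}"
  have "(\<Union>j\<in>UNIV. ?I j) = B"
    using assms(2) by (auto simp: UNIV_bool)
  then have "indep_sets (\<lambda>j. sigma_sets (space M) (\<Union>i\<in>?I j. Z i)) UNIV"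
    using assms by (intro indep_sets_collect_sigma) (auto simp: disjoint_family_on_def split: if_splits)
  then show ?thesis
    unfolding indep_set_def by (rule indep_sets_mono_sets) (auto split: bool.split)
qed

text \<open>The products of indicators are indicators of finite cylinders, which form an
  intersection-stable generator of \<open>J\<close>. Agreement on it makes \<open>v\<close> a
  version of the conditional expectation of \<open>u\<close> given \<open>J\<close>, which is
  \<open>u\<close> itself.\<close>

lemma AE_eq_if_integral_mult_prod_eq:
  fixes u v :: "'a \<Rightarrow> real"
  assumes Z: "\<And>\<beta>. \<beta> \<in> B \<Longrightarrow> Z \<beta> \<in> complete_subfields M"
    and J: "subalgebra M J" "sets J = sigma_sets (space M) (\<Union>\<beta>\<in>B. Z \<beta>)"
    and u: "integrable M u" "u \<in> borel_measurable J"
    and v: "integrable M v" "v \<in> borel_measurable J"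
    and eq: "\<And>K D. finite K \<Longrightarrow> K \<subseteq> B \<Longrightarrow> (\<And>\<beta>. \<beta> \<in> K \<Longrightarrow> D \<beta> \<in> Z \<beta>) \<Longrightarrow>
      (LINT x|M. u x * (\<Prod>\<beta>\<in>K. indicator (D \<beta>) x)) = (LINT x|M. v x * (\<Prod>\<beta>\<in>K. indicator (D \<beta>) x))"
  shows "AE x in M. u x = v x"
proof -
  interpret J: finite_measure_subalgebra M J using J(1) by (rule finite_measure_subalgebraI)
  \<comment> \<open>Restricting to \<open>space M\<close> makes the cylinder over the empty
    \<open>K\<close> the whole space.\<close>
  define cyl where "cyl K D = {x \<in> space M. \<forall>\<beta>\<in>K. x \<in> D \<beta>}" for K and D :: "'b \<Rightarrow> 'a set"
  define G where "G = {cyl K D |K D. finite K \<and> K \<subseteq> B \<and> (\<forall>\<beta>\<in>K. D \<beta> \<in> Z \<beta>)}"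
  have ZM: "Z \<beta> \<subseteq> sets M" and Zalg: "sigma_algebra (space M) (Z \<beta>)" if "\<beta> \<in> B" for \<beta>
    using Z[OF that] by (auto simp: complete_subfields_def)
  have GM: "G \<subseteq> sets M"
  proof
    fix C assume "C \<in> G"
    then obtain K D where K: "finite K" "K \<subseteq> B" "\<forall>\<beta>\<in>K. D \<beta> \<in> Z \<beta>" and C: "C = cyl K D"
      unfolding G_def by blast
    have "{x \<in> space M. x \<in> D \<beta>} \<in> sets M" if "\<beta> \<in> K" for \<beta>
    proof -
      have "D \<beta> \<in> sets M" using that K ZM by blast
      moreover have "{x \<in> space M. x \<in> D \<beta>} = D \<beta>"
        using sets.sets_into_space[OF \<open>D \<beta> \<in> sets M\<close>] by blast
      ultimately show ?thesis by simp
    qed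
    then show "C \<in> sets M"
      unfolding C cyl_def using K(1) by (intro sets.sets_Collect_finite_All)
  qed
  have "Int_stable G"
  proof (rule Int_stableI)
    fix C C' assume "C \<in> G" "C' \<in> G"
    then obtain K D K' D' where K: "finite K" "K \<subseteq> B" "\<forall>\<beta>\<in>K. D \<beta> \<in> Z \<beta>"
      and K': "finite K'" "K' \<subseteq> B" "\<forall>\<beta>\<in>K'. D' \<beta> \<in> Z \<beta>" and C: "C = cyl K D" "C' = cyl K' D'"
      unfolding G_def by blast
    \<comment> \<open>Padding with \<open>space M\<close> lets both cylinders be read over the
      common index set \<open>K \<union> K'\<close>.\<close>
    define D'' where "D'' \<beta> = (if \<beta> \<in> K then D \<beta> else space M) \<inter> (if \<beta> \<in> K' then D' \<beta> else space M)" for \<beta>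
    have "D'' \<beta> \<in> Z \<beta>" if "\<beta> \<in> K \<union> K'" for \<beta>
    proof -
      have \<beta>: "\<beta> \<in> B" using that K K' by blast
      interpret sigma_algebra "space M" "Z \<beta>" by (rule Zalg[OF \<beta>])
      show ?thesis using K K' by (auto simp: D''_def)
    qed
    moreover have "C \<inter> C' = cyl (K \<union> K') D''"
      by (auto simp: C cyl_def D''_def)
    ultimately show "C \<inter> C' \<in> G"
      unfolding G_def using K K' by blast
  qed
  have "space M \<in> G"
    unfolding G_def by (auto simp: cyl_def intro!: exI[of _ "{}"])
  have "Z \<beta> \<subseteq> G" if \<beta>: "\<beta> \<in> B" for \<beta>
  proof
    fix D assume D: "D \<in> Z \<beta>"
    then have "D = cyl {\<beta>} (\<lambda>_. D)"
      using ZM[OF \<beta>] sets.sets_into_space[of D M] by (auto simp: cyl_def)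
    then show "D \<in> G" unfolding G_def using D \<beta> by blast
  qed
  then have JG: "sets J \<subseteq> sigma_sets (space M) G"
    unfolding J(2) by (intro sigma_sets_mono') blast
  have on_G: "(LINT x:C|M. u x) = (LINT x:C|M. v x)" if "C \<in> G" for C
  proof -
    obtain K D where K: "finite K" "K \<subseteq> B" "\<forall>\<beta>\<in>K. D \<beta> \<in> Z \<beta>" and C: "C = cyl K D"
      using \<open>C \<in> G\<close> unfolding G_def by blast
    have ind: "(\<Prod>\<beta>\<in>K. indicator (D \<beta>) x) = (indicator C x :: real)" if x: "x \<in> space M" for x
    proof (cases "x \<in> C")
      case True
      then show ?thesis by (simp add: C cyl_def)
    next
      case False
      then obtain \<beta> where "\<beta> \<in> K" "x \<notin> D \<beta>" using x by (auto simp: C cyl_def)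
      then have "(\<Prod>\<beta>\<in>K. indicator (D \<beta>) x) = (0 :: real)"
        using K(1) by (intro prod_zero) (auto intro!: bexI[of _ \<beta>])
      with False show ?thesis by simp
    qed
    have "(LINT x:C|M. w x) = (LINT x|M. w x * (\<Prod>\<beta>\<in>K. indicator (D \<beta>) x))" for w :: "'a \<Rightarrow> real"
      unfolding set_lebesgue_integral_def by (rule Bochner_Integration.integral_cong) (auto simp: ind)
    then show ?thesis using eq[of K D] K by simp
  qed
  have "AE x in M. real_cond_exp M J u x = v x"
  proof (rule J.real_cond_exp_charact)
    fix C assume "C \<in> sets J"
    then show "(LINT x:C|M. u x) = (LINT x:C|M. v x)"
      using JG
      by (intro set_integral_eq_on_sigma_sets[OF u(1) v(1) \<open>Int_stable G\<close> GM \<open>space M \<in> G\<close> on_G]) auto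
  qed (use u v in auto)
  moreover have "AE x in M. real_cond_exp M J u x = u x"
    using u by (rule J.real_cond_exp_F_meas)
  ultimately show ?thesis by eventually_elim simp
qed

section \<open>The inclusion of the meet of joins in the join of meets\<close>

context
  fixes A :: "'i set" and B :: "'b set" and X :: "'i \<Rightarrow> 'b \<Rightarrow> 'a set set"
  assumes A: "A \<noteq> {}"
    and X: "\<And>\<alpha> \<beta>. \<alpha> \<in> A \<Longrightarrow> \<beta> \<in> B \<Longrightarrow> X \<alpha> \<beta> \<in> complete_subfields M"
    and ind: "indep_sets (\<lambda>\<beta>. join_fields M A (\<lambda>\<alpha>. X \<alpha> \<beta>)) B"
begin

private abbreviation Z :: "'b \<Rightarrow> 'a set set" where
  "Z \<beta> \<equiv> join_fields M A (\<lambda>\<alpha>. X \<alpha> \<beta>)"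

private abbreviation Y :: "'b \<Rightarrow> 'a set set" where
  "Y \<beta> \<equiv> meet_fields A (\<lambda>\<alpha>. X \<alpha> \<beta>)"

private abbreviation J :: "'i \<Rightarrow> 'a set set" where
  "J \<alpha> \<equiv> join_fields M B (\<lambda>\<beta>. X \<alpha> \<beta>)"

lemma Z_complete: "\<beta> \<in> B \<Longrightarrow> Z \<beta> \<in> complete_subfields M"
  using X by (intro join_fields_in_complete_subfields)

lemma Y_complete: "\<beta> \<in> B \<Longrightarrow> Y \<beta> \<in> complete_subfields M"
  using A X by (intro meet_fields_in_complete_subfields)

lemma J_complete: "\<alpha> \<in> A \<Longrightarrow> J \<alpha> \<in> complete_subfields M"
  using X by (intro join_fields_in_complete_subfields)

lemma Y_subset_Z: "Y \<beta> \<subseteq> Z \<beta>"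
  using A join_fields_upper[of _ A "\<lambda>\<alpha>. X \<alpha> \<beta>" M] by (fastforce simp: meet_fields_def)

lemma Z_alg: "\<beta> \<in> B \<Longrightarrow> subalgebra M (sigma (space M) (Z \<beta>))"
  by (rule subalgebra_complete_subfield[OF Z_complete])

lemma Y_alg: "\<beta> \<in> B \<Longrightarrow> subalgebra M (sigma (space M) (Y \<beta>))"
  by (rule subalgebra_complete_subfield[OF Y_complete])

lemma cond_exp_Y:
  assumes "\<beta> \<in> B" "h \<in> contractions (sigma (space M) (Z \<beta>))"
  shows "real_cond_exp M (sigma (space M) (Y \<beta>)) h \<in> contractions (sigma (space M) (Y \<beta>))"
  by (rule contractions_cond_exp[OF Y_alg[OF assms(1)] contractions_mono[OF Z_alg[OF assms(1)] assms(2)]])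

lemma Z_Y_alg: "\<beta> \<in> B \<Longrightarrow> subalgebra (sigma (space M) (Z \<beta>)) (sigma (space M) (Y \<beta>))"
  by (rule subalgebra_complete_subfields[OF Z_complete Y_complete Y_subset_Z])

text \<open>Instance of the replacement rule with \<open>P\<close> generated by all
  \<open>Z \<gamma>\<close> for \<open>\<gamma>\<close> other than \<open>\<beta>\<close>. For every
  \<open>\<alpha>\<close> the field \<open>J \<alpha>\<close> lies in the join of \<open>P\<close>
  and \<open>X \<alpha> \<beta>\<close>, and the remaining factors are
  \<open>P\<close>-measurable.\<close>

lemma integral_mult_replace_factor:
  assumes f: "\<And>\<alpha>. \<alpha> \<in> A \<Longrightarrow> f \<in> contractions (sigma (space M) (J \<alpha>))"
    and \<beta>: "\<beta> \<in> B" and K: "K \<subseteq> B - {\<beta>}"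
    and g: "\<And>\<gamma>. \<gamma> \<in> K \<Longrightarrow> g \<gamma> \<in> contractions (sigma (space M) (Z \<gamma>))"
    and h: "h \<in> contractions (sigma (space M) (Z \<beta>))"
  shows "(LINT x|M. f x * (\<Prod>\<gamma>\<in>K. g \<gamma> x) * h x) =
    (LINT x|M. f x * (\<Prod>\<gamma>\<in>K. g \<gamma> x) * real_cond_exp M (sigma (space M) (Y \<beta>)) h x)"
proof -
  define P where "P = sigma (space M) (\<Union>\<gamma>\<in>B - {\<beta>}. Z \<gamma>)"
  have ZM: "Z \<gamma> \<subseteq> sets M" if "\<gamma> \<in> B" for \<gamma>
    using Z_complete[OF that] by (simp add: complete_subfields_def)
  have UM: "(\<Union>\<gamma>\<in>B - {\<beta>}. Z \<gamma>) \<subseteq> sets M" using ZM by blast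
  have P: "subalgebra M P" unfolding P_def using UM by (rule subalgebra_sigma)
  have sP: "sets P = sigma_sets (space M) (\<Union>\<gamma>\<in>B - {\<beta>}. Z \<gamma>)"
    unfolding P_def by (rule sets_measure_of) (use UM sets.space_closed in blast)
  have XZ: "X \<alpha> \<gamma> \<subseteq> Z \<gamma>" if "\<alpha> \<in> A" for \<alpha> \<gamma>
    using join_fields_upper[OF that, of "\<lambda>\<alpha>. X \<alpha> \<gamma>"] .
  note sets_eq = sets_sigma_complete_subfield
  have Int_Z: "Int_stable (Z \<gamma>)" if "\<gamma> \<in> B" for \<gamma>
    using sets.Int_stable[of "sigma (space M) (Z \<gamma>)"] by (simp add: sets_eq[OF Z_complete[OF that]])
  have "indep_set (sets P) (sets (sigma (space M) (Z \<beta>)))"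
    using indep_set_rest[OF ind \<beta> Int_Z] by (simp add: sP sets_eq Z_complete \<beta>)
  then show ?thesis
  proof (rule integral_mult_cond_exp_Inter[where A = A and X = "\<lambda>\<alpha>. sigma (space M) (X \<alpha> \<beta>)"])
    show "subalgebra M (sigma (space M) (Z \<beta>))" "subalgebra M (sigma (space M) (Y \<beta>))"
      using \<beta> by (rule Z_alg Y_alg)+
    show "sets (sigma (space M) (Y \<beta>)) = (\<Inter>\<alpha>\<in>A. sets (sigma (space M) (X \<alpha> \<beta>)))"
      using X \<beta> Y_complete by (simp add: sets_eq meet_fields_def)
    fix \<alpha> assume \<alpha>: "\<alpha> \<in> A"
    show "subalgebra (sigma (space M) (Z \<beta>)) (sigma (space M) (X \<alpha> \<beta>))"
      by (rule subalgebra_complete_subfields[OF Z_complete[OF \<beta>] X[OF \<alpha> \<beta>] XZ[OF \<alpha>]])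
    show "null_sets M \<subseteq> sets (sigma (space M) (X \<alpha> \<beta>))"
      by (rule null_sets_complete_subfield[OF X[OF \<alpha> \<beta>]])
    define V where "V = sigma (space M) (sets P \<union> sets (sigma (space M) (X \<alpha> \<beta>)))"
    have gen: "sets P \<union> X \<alpha> \<beta> \<subseteq> sets M"
      using P XZ[OF \<alpha>] ZM[OF \<beta>] by (auto simp: subalgebra_def)
    have sV: "sets V = sigma_sets (space M) (sets P \<union> X \<alpha> \<beta>)"
      unfolding V_def sets_eq[OF X[OF \<alpha> \<beta>]]
      by (rule sets_measure_of) (use gen sets.space_closed in blast)
    have spV: "space V = space M" by (simp add: V_def space_measure_of_conv)
    \<comment> \<open>For \<open>\<gamma> = \<beta>\<close> this is a generator of \<open>V\<close>;
      otherwise \<open>X \<alpha> \<gamma>\<close> lies in \<open>Z \<gamma>\<close>, hence in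
      \<open>P\<close>.\<close>
    have XV: "X \<alpha> \<gamma> \<subseteq> sets V" if "\<gamma> \<in> B" for \<gamma>
      using XZ[OF \<alpha>, of \<gamma>] that by (cases "\<gamma> = \<beta>") (auto simp: sV sP intro!: sigma_sets.Basic)
    have "J \<alpha> = sigma_sets (space M) (\<Union>\<gamma>\<in>B. X \<alpha> \<gamma>)"
      using \<beta> X[OF \<alpha>] by (intro join_fields_eq_sigma_sets) auto
    also have "\<dots> \<subseteq> sets V"
      using sets.sigma_sets_subset[of "\<Union>\<gamma>\<in>B. X \<alpha> \<gamma>" V] XV by (auto simp: spV)
    finally have "subalgebra V (sigma (space M) (J \<alpha>))"
      using sets_eq[OF J_complete[OF \<alpha>]] by (simp add: subalgebra_def spV space_measure_of_conv)
    then have fV: "f \<in> contractions V" using f[OF \<alpha>] by (rule contractions_mono)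
    have "subalgebra V (sigma (space M) (Z \<gamma>))" if "\<gamma> \<in> K" for \<gamma>
    proof -
      have \<gamma>: "\<gamma> \<in> B - {\<beta>}" using that K by blast
      then have "Z \<gamma> \<subseteq> sets P" by (auto simp: sP)
      also have "\<dots> \<subseteq> sets V" by (auto simp: sV)
      finally show ?thesis
        using \<gamma> sets_eq[OF Z_complete] by (simp add: subalgebra_def spV space_measure_of_conv)
    qed
    then have "(\<lambda>x. \<Prod>\<gamma>\<in>K. g \<gamma> x) \<in> contractions V"
      using g contractions_mono by (intro contractions_prod) blast
    with fV show "(\<lambda>x. f x * (\<Prod>\<gamma>\<in>K. g \<gamma> x)) \<in> contractions V"
      by (rule contractions_mult)
  qed (use A P h in auto)
qed

lemma integral_mult_prod_cond_exp:
  assumes f: "\<And>\<alpha>. \<alpha> \<in> A \<Longrightarrow> f \<in> contractions (sigma (space M) (J \<alpha>))"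
    and G: "finite G" "G \<subseteq> B"
    and h: "\<And>\<beta>. \<beta> \<in> G \<Longrightarrow> h \<beta> \<in> contractions (sigma (space M) (Z \<beta>))"
  shows "(LINT x|M. f x * (\<Prod>\<beta>\<in>G. h \<beta> x)) =
    (LINT x|M. f x * (\<Prod>\<beta>\<in>G. real_cond_exp M (sigma (space M) (Y \<beta>)) (h \<beta>) x))"
proof -
  define e where "e \<beta> = real_cond_exp M (sigma (space M) (Y \<beta>)) (h \<beta>)" for \<beta>
  \<comment> \<open>Hybrid products: the factors indexed by \<open>F\<close> are already projected.
    They stay \<open>Z \<beta>\<close>-measurable, so the replacement can be repeated while
    \<open>F\<close> grows from the empty set to \<open>G\<close>.\<close>
  define H where "H F \<beta> = (if \<beta> \<in> F then e \<beta> else h \<beta>)" for F \<beta>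
  have HZ: "H F \<beta> \<in> contractions (sigma (space M) (Z \<beta>))" if "\<beta> \<in> G" for F \<beta>
    using that G h cond_exp_Y contractions_mono[OF Z_Y_alg] by (auto simp: H_def e_def)
  have "finite F \<Longrightarrow> F \<subseteq> G \<Longrightarrow> (LINT x|M. f x * (\<Prod>\<beta>\<in>G. h \<beta> x)) = (LINT x|M. f x * (\<Prod>\<beta>\<in>G. H F \<beta> x))" for F
  proof (induction F rule: finite_induct)
    case empty
    then show ?case by (simp add: H_def)
  next
    case (insert \<beta> F)
    have \<beta>: "\<beta> \<in> G" "\<beta> \<notin> F" using insert by auto
    have rem: "(\<Prod>\<gamma>\<in>G. H F' \<gamma> x) = (\<Prod>\<gamma>\<in>G - {\<beta>}. H F' \<gamma> x) * H F' \<beta> x" for F' x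
      using prod.remove[OF G(1) \<beta>(1), of "\<lambda>\<gamma>. H F' \<gamma> x"] by (simp add: mult.commute)
    have "(LINT x|M. f x * (\<Prod>\<gamma>\<in>G. H F \<gamma> x)) = (LINT x|M. f x * (\<Prod>\<gamma>\<in>G - {\<beta>}. H F \<gamma> x) * h \<beta> x)"
      using \<beta> by (simp add: rem mult.assoc) (simp add: H_def)
    also have "\<dots> = (LINT x|M. f x * (\<Prod>\<gamma>\<in>G - {\<beta>}. H F \<gamma> x) * e \<beta> x)"
      unfolding e_def using \<beta> G h HZ by (intro integral_mult_replace_factor f) auto
    also have "\<dots> = (LINT x|M. f x * (\<Prod>\<gamma>\<in>G - {\<beta>}. H (insert \<beta> F) \<gamma> x) * H (insert \<beta> F) \<beta> x)"
      by (intro Bochner_Integration.integral_cong refl arg_cong2[where f = "(*)"] prod.cong)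
        (auto simp: H_def)
    also have "\<dots> = (LINT x|M. f x * (\<Prod>\<gamma>\<in>G. H (insert \<beta> F) \<gamma> x))"
      by (simp add: rem mult.assoc)
    finally show ?case using insert by simp
  qed
  from this[OF G(1) subset_refl] show ?thesis
    by (simp add: H_def e_def cong: prod.cong)
qed

lemma meet_join_subset_join_meet:
  assumes B: "B \<noteq> {}"
  shows "meet_fields A J \<subseteq> join_fields M B Y"
proof
  fix E assume "E \<in> meet_fields A J"
  then have E: "E \<in> J \<alpha>" if "\<alpha> \<in> A" for \<alpha> using that by (simp add: meet_fields_def)
  note sets_eq = sets_sigma_complete_subfield
  define S where "S = sigma (space M) (join_fields M B Y)"
  define U where "U = sigma (space M) (join_fields M B Z)"
  have SC: "join_fields M B Y \<in> complete_subfields M"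
    using Y_complete by (intro join_fields_in_complete_subfields)
  have UC: "join_fields M B Z \<in> complete_subfields M"
    using Z_complete by (rule join_fields_in_complete_subfields)
  have S: "subalgebra M S" unfolding S_def using SC by (rule subalgebra_complete_subfield)
  have U: "subalgebra M U" unfolding U_def using UC by (rule subalgebra_complete_subfield)
  define f where "f = (indicator E :: 'a \<Rightarrow> real)"
  have fJ: "f \<in> contractions (sigma (space M) (J \<alpha>))" if "\<alpha> \<in> A" for \<alpha>
    unfolding f_def using E[OF that] by (intro contractions_indicator) (simp add: sets_eq J_complete that)
  obtain \<alpha>0 where \<alpha>0: "\<alpha>0 \<in> A" using A by blast
  have fM: "f \<in> contractions M"
    using contractions_mono[OF subalgebra_complete_subfield[OF J_complete[OF \<alpha>0]] fJ[OF \<alpha>0]] .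
  define f' where "f' = real_cond_exp M S f"
  have f'S: "f' \<in> contractions S" unfolding f'_def using S fM by (rule contractions_cond_exp)
  \<comment> \<open>This makes \<open>f'\<close> measurable for every \<open>J \<alpha>\<close>, so
    the replacement of factors applies to \<open>f'\<close> exactly as to \<open>f\<close>.\<close>
  have SJ: "subalgebra (sigma (space M) (J \<alpha>)) S" if \<alpha>: "\<alpha> \<in> A" for \<alpha>
    unfolding S_def
  proof (rule subalgebra_complete_subfields[OF J_complete[OF \<alpha>] SC join_fields_least[OF J_complete[OF \<alpha>]]])
    fix \<beta> assume "\<beta> \<in> B"
    then show "Y \<beta> \<subseteq> J \<alpha>"
      using join_fields_upper[of \<beta> B "X \<alpha>" M] \<alpha> by (fastforce simp: meet_fields_def)
  qed
  have f'J: "f' \<in> contractions (sigma (space M) (J \<alpha>))" if "\<alpha> \<in> A" for \<alpha>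
    using contractions_mono[OF SJ[OF that] f'S] .
  have UJ: "subalgebra U (sigma (space M) (J \<alpha>0))"
    unfolding U_def
  proof (rule subalgebra_complete_subfields[OF UC J_complete[OF \<alpha>0] join_fields_least[OF UC]])
    fix \<beta> assume "\<beta> \<in> B"
    then show "X \<alpha>0 \<beta> \<subseteq> join_fields M B Z"
      using join_fields_upper[of \<beta> B Z M] join_fields_upper[OF \<alpha>0, of "\<lambda>\<alpha>. X \<alpha> \<beta>" M] by blast
  qed
  have "AE x in M. f x = f' x"
  proof (rule AE_eq_if_integral_mult_prod_eq[OF Z_complete U])
    show "sets U = sigma_sets (space M) (\<Union>\<beta>\<in>B. Z \<beta>)"
      unfolding U_def sets_eq[OF UC] by (rule join_fields_eq_sigma_sets[OF B Z_complete])
    show "integrable M f" "integrable M f'"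
      using fM contractions_mono[OF S f'S] by (auto intro: contractions_integrable)
    show "f \<in> borel_measurable U" "f' \<in> borel_measurable U"
      using contractions_mono[OF UJ] fJ[OF \<alpha>0] f'J[OF \<alpha>0] contractions_measurable by blast+
    fix K and D :: "'b \<Rightarrow> 'a set"
    assume K: "finite K" "K \<subseteq> B" and D: "\<And>\<beta>. \<beta> \<in> K \<Longrightarrow> D \<beta> \<in> Z \<beta>"
    define h where "h \<beta> = (indicator (D \<beta>) :: 'a \<Rightarrow> real)" for \<beta>
    define e where "e \<beta> = real_cond_exp M (sigma (space M) (Y \<beta>)) (h \<beta>)" for \<beta>
    have h: "h \<beta> \<in> contractions (sigma (space M) (Z \<beta>))" if "\<beta> \<in> K" for \<beta>
      unfolding h_def using D[OF that] that K(2)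
      by (intro contractions_indicator) (auto simp: sets_eq[OF Z_complete])
    have e: "e \<beta> \<in> contractions S" if "\<beta> \<in> K" for \<beta>
    proof -
      have \<beta>: "\<beta> \<in> B" using that K by blast
      have "subalgebra S (sigma (space M) (Y \<beta>))"
        unfolding S_def
        by (rule subalgebra_complete_subfields[OF SC Y_complete[OF \<beta>] join_fields_upper[OF \<beta>]])
      then show ?thesis
        unfolding e_def using cond_exp_Y[OF \<beta> h[OF that]] by (rule contractions_mono)
    qed
    have eS: "(\<lambda>x. \<Prod>\<beta>\<in>K. e \<beta> x) \<in> contractions S" using e by (rule contractions_prod)
    \<comment> \<open>Once all factors are projected their product is \<open>S\<close>-measurable,
      so \<open>f\<close> may be exchanged for its projection \<open>f'\<close>; the factors are
      then restored.\<close>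
    have "(LINT x|M. f x * (\<Prod>\<beta>\<in>K. h \<beta> x)) = (LINT x|M. f x * (\<Prod>\<beta>\<in>K. e \<beta> x))"
      unfolding e_def by (rule integral_mult_prod_cond_exp[OF fJ K h])
    also have "\<dots> = (LINT x|M. f' x * (\<Prod>\<beta>\<in>K. e \<beta> x))"
      using integral_mult_cond_exp[OF S eS fM] by (simp add: f'_def mult.commute)
    also have "\<dots> = (LINT x|M. f' x * (\<Prod>\<beta>\<in>K. h \<beta> x))"
      unfolding e_def by (rule integral_mult_prod_cond_exp[OF f'J K h, symmetric])
    finally show "(LINT x|M. f x * (\<Prod>\<beta>\<in>K. indicator (D \<beta>) x)) =
        (LINT x|M. f' x * (\<Prod>\<beta>\<in>K. indicator (D \<beta>) x))"
      unfolding h_def .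
  qed
  \<comment> \<open>Almost sure equality with \<open>f'\<close> is enough because \<open>S\<close>
    contains the null events; measurability of the indicator then puts \<open>E\<close> itself in
    the join.\<close>
  then have "f \<in> borel_measurable S"
    using S null_sets_complete_subfield[OF SC] contractions_measurable[OF f'S] contractions_measurable[OF fM]
    unfolding S_def by (rule borel_measurable_AE_eq_null_sets[rotated 4])
  moreover have "E \<subseteq> space M"
    using E[OF \<alpha>0] J_complete[OF \<alpha>0] sets.sets_into_space by (auto simp: complete_subfields_def)
  ultimately show "E \<in> join_fields M B Y"
    by (simp add: borel_measurable_indicator_iff f_def S_def sets_eq[OF SC] space_measure_of_conv Int_absorb1 Int_absorb2)
qed

end

end

section \<open>Equality of the two fields\<close>

theorem proposition3p4:
  fixes M :: "'w measure"
    and A :: "'a set" and B :: "'b set"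
    and X :: "'a \<Rightarrow> 'b \<Rightarrow> 'w set set"
  assumes "prob_space M"
    and "A \<noteq> {}"
    and "\<And>\<alpha> \<beta>. \<alpha> \<in> A \<Longrightarrow> \<beta> \<in> B \<Longrightarrow> X \<alpha> \<beta> \<in> complete_subfields M"
    and "prob_space.indep_sets M (\<lambda>\<beta>. join_fields M A (\<lambda>\<alpha>. X \<alpha> \<beta>)) B"
  shows "meet_fields A (\<lambda>\<alpha>. join_fields M B (\<lambda>\<beta>. X \<alpha> \<beta>)) =
         join_fields M B (\<lambda>\<beta>. meet_fields A (\<lambda>\<alpha>. X \<alpha> \<beta>))"
proof (cases "B = {}")
  case True
  \<comment> \<open>With \<open>B\<close> empty every join is the field of trivial events, and the
    meet over the nonempty \<open>A\<close> of this constant family is the same field.\<close>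
  then show ?thesis
    using assms(2) by (simp add: join_fields_empty[OF assms(1)] meet_fields_def)
next
  case False
  interpret prob_space M by fact
  show ?thesis
  proof
    show "meet_fields A (\<lambda>\<alpha>. join_fields M B (\<lambda>\<beta>. X \<alpha> \<beta>))
        \<subseteq> join_fields M B (\<lambda>\<beta>. meet_fields A (\<lambda>\<alpha>. X \<alpha> \<beta>))"
      using assms(2-4) False by (rule meet_join_subset_join_meet)
    \<comment> \<open>The reverse inclusion is lattice-theoretic: the left side is a complete
      subfield above each meet, so minimality of the join applies.\<close>
    have "meet_fields A (\<lambda>\<alpha>. join_fields M B (\<lambda>\<beta>. X \<alpha> \<beta>)) \<in> complete_subfields M"
      using assms(2,3) by (intro meet_fields_in_complete_subfields join_fields_in_complete_subfields)
    then show "join_fields M B (\<lambda>\<beta>. meet_fields A (\<lambda>\<alpha>. X \<alpha> \<beta>))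
        \<subseteq> meet_fields A (\<lambda>\<alpha>. join_fields M B (\<lambda>\<beta>. X \<alpha> \<beta>))"
    proof (rule join_fields_least)
      fix \<beta> assume "\<beta> \<in> B"
      then show "meet_fields A (\<lambda>\<alpha>. X \<alpha> \<beta>) \<subseteq> meet_fields A (\<lambda>\<alpha>. join_fields M B (\<lambda>\<beta>. X \<alpha> \<beta>))"
        using join_fields_upper[of \<beta> B _ M] by (fastforce simp: meet_fields_def)
    qed
  qed
qed

end
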